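(* Let $(X,d_X)$ be an infinite non-extended metric space of bounded geometry. Then there is a countable inverse semigroup $S$ and an $\mathcal L$-class $L\subset S$ such that $(L,d_S)$ is bijectively coarsely equivalent to $(X,d_X)$, where $d_S$ is any proper and right subinvariant metric on $S$ (restricted to $L$).
   Context: An inverse semigroup is a semigroup $S$ in which every $s\in S$ has a unique element $s^*$ with $ss^*s=s$ and $s^*ss^*=s^*$. Green's relation $\mathcal L$: $s\mathrel{\mathcal L}t$ iff $s^*s=t^*t$. An extended metric takes values in $[0,\infty]$ and satisfies the usual metric axioms; its components are the classes of the relation $d(x,y)<\infty$; non-extended means that $\infty$ is not attained. A metric space is uniformly discrete if there is $c>0$ with $d(x,y)>c$ for all $x\neq y$, and it is of bounded geometry if it is uniformly discrete and $\sup_{x}|B_r(x)|<\infty$ for every $r>0$, where $B_r(x)=\{y: d(x,y)\le r\}$. A metric on an inverse semigroup $S$ always means a uniformly discrete extended metric whose components are exactly the $\mathcal L$-classes. It is right subinvariant if $d(sx,tx)\le d(s,t)$ for all $s,t,x\in S$, and proper if for every $r\ge0$ there is a finite $F\subset S$ such that $y\in Fx$ whenever $x\neq y$ and $d(x,y)\le r$. A coarse equivalence $f\colon X\to Y$ is a map for which there are non-decreasing $\rho_-,\rho_+\colon[0,\infty]\to[0,\infty]$ with $\rho_+^{-1}(\infty)=\{\infty\}$, $\rho_-(r)\to\infty$ as $r\to\infty$, $\rho_-(d_X(x,y))\le d_Y(f(x),f(y))\le\rho_+(d_X(x,y))$ for all $x,y$, and such that some $k$-neighbourhood of $f(X)$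 is $Y$. Two spaces are bijectively coarsely equivalent if there is a bijective coarse equivalence between them. *)

theory Defs
  imports "HOL-Analysis.Analysis" "HOL-Library.Extended_Nonnegative_Real"
begin

section \<open>Extended metric spaces\<close>

text \<open>Spaces are given by a carrier set and a distance function with values in \<open>[0,\<infinity>]\<close>;
  the values of the distance function outside the carrier are irrelevant.\<close>

definition extended_metric_on :: "'a set \<Rightarrow> ('a \<Rightarrow> 'a \<Rightarrow> ennreal) \<Rightarrow> bool" where
  "extended_metric_on X d \<longleftrightarrow>
     (\<forall>x\<in>X. \<forall>y\<in>X. d x y = 0 \<longleftrightarrow> x = y) \<and>
     (\<forall>x\<in>X. \<forall>y\<in>X. d x y = d y x) \<and>
     (\<forall>x\<in>X. \<forall>y\<in>X. \<forall>z\<in>X. d x z \<le> d x y + d y z)"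

definition non_extended_on :: "'a set \<Rightarrow> ('a \<Rightarrow> 'a \<Rightarrow> ennreal) \<Rightarrow> bool" where
  "non_extended_on X d \<longleftrightarrow> (\<forall>x\<in>X. \<forall>y\<in>X. d x y < \<infinity>)"

definition metric_components :: "'a set \<Rightarrow> ('a \<Rightarrow> 'a \<Rightarrow> ennreal) \<Rightarrow> 'a set set" where
  "metric_components X d = X // {(x, y). x \<in> X \<and> y \<in> X \<and> d x y < \<infinity>}"

definition uniformly_discrete_on :: "'a set \<Rightarrow> ('a \<Rightarrow> 'a \<Rightarrow> ennreal) \<Rightarrow> bool" where
  "uniformly_discrete_on X d \<longleftrightarrow>
     (\<exists>c::real. c > 0 \<and> (\<forall>x\<in>X. \<forall>y\<in>X. x \<noteq> y \<longrightarrow> d x y > ennreal c))"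

definition closed_ball_on :: "'a set \<Rightarrow> ('a \<Rightarrow> 'a \<Rightarrow> ennreal) \<Rightarrow> real \<Rightarrow> 'a \<Rightarrow> 'a set" where
  "closed_ball_on X d r x = {y \<in> X. d x y \<le> ennreal r}"

text \<open>Finiteness of the balls is stated separately, as \<^const>\<open>card\<close> vanishes on infinite sets.\<close>

definition bounded_geometry_on :: "'a set \<Rightarrow> ('a \<Rightarrow> 'a \<Rightarrow> ennreal) \<Rightarrow> bool" where
  "bounded_geometry_on X d \<longleftrightarrow>
     uniformly_discrete_on X d \<and>
     (\<forall>r>0. \<exists>N::nat. \<forall>x\<in>X.
        finite (closed_ball_on X d r x) \<and> card (closed_ball_on X d r x) \<le> N)"

section \<open>Coarse equivalences\<close>

definition coarse_equivalence ::
  "'a set \<Rightarrow> ('a \<Rightarrow> 'a \<Rightarrow> ennreal) \<Rightarrow> 'b set \<Rightarrow> ('b \<Rightarrow> 'b \<Rightarrow> ennreal) \<Rightarrow> ('a \<Rightarrow> 'b) \<Rightarrow> bool" where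
  "coarse_equivalence X dX Y dY f \<longleftrightarrow>
     f ` X \<subseteq> Y \<and>
     (\<exists>\<rho>m \<rho>p :: ennreal \<Rightarrow> ennreal.
        mono \<rho>m \<and> mono \<rho>p \<and>
        \<rho>p -` {\<infinity>} = {\<infinity>} \<and>
        (\<rho>m \<longlongrightarrow> \<infinity>) (at \<infinity>) \<and>
        (\<forall>x\<in>X. \<forall>y\<in>X.
           \<rho>m (dX x y) \<le> dY (f x) (f y) \<and> dY (f x) (f y) \<le> \<rho>p (dX x y))) \<and>
     (\<exists>k::real. k \<ge> 0 \<and> (\<forall>y\<in>Y. \<exists>x\<in>X. dY (f x) y \<le> ennreal k))"

definition bijectively_coarsely_equivalent ::
  "'a set \<Rightarrow> ('a \<Rightarrow> 'a \<Rightarrow> ennreal) \<Rightarrow> 'b set \<Rightarrow> ('b \<Rightarrow> 'b \<Rightarrow> ennreal) \<Rightarrow> bool" where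
  "bijectively_coarsely_equivalent X dX Y dY \<longleftrightarrow>
     (\<exists>f. bij_betw f X Y \<and> coarse_equivalence X dX Y dY f)"

section \<open>Inverse semigroups\<close>

definition is_semigroup_inverse :: "'s set \<Rightarrow> ('s \<Rightarrow> 's \<Rightarrow> 's) \<Rightarrow> 's \<Rightarrow> 's \<Rightarrow> bool" where
  "is_semigroup_inverse S m s t \<longleftrightarrow> t \<in> S \<and> m (m s t) s = s \<and> m (m t s) t = t"

definition inverse_semigroup_on :: "'s set \<Rightarrow> ('s \<Rightarrow> 's \<Rightarrow> 's) \<Rightarrow> bool" where
  "inverse_semigroup_on S m \<longleftrightarrow>
     (\<forall>s\<in>S. \<forall>t\<in>S. m s t \<in> S) \<and>
     (\<forall>s\<in>S. \<forall>t\<in>S. \<forall>u\<in>S. m (m s t) u = m s (m t u)) \<and>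
     (\<forall>s\<in>S. \<exists>!t. is_semigroup_inverse S m s t)"

definition star :: "'s set \<Rightarrow> ('s \<Rightarrow> 's \<Rightarrow> 's) \<Rightarrow> 's \<Rightarrow> 's" where
  "star S m s = (THE t. is_semigroup_inverse S m s t)"

definition green_L :: "'s set \<Rightarrow> ('s \<Rightarrow> 's \<Rightarrow> 's) \<Rightarrow> ('s \<times> 's) set" where
  "green_L S m = {(s, t). s \<in> S \<and> t \<in> S \<and> m (star S m s) s = m (star S m t) t}"

section \<open>Metrics on inverse semigroups\<close>

definition semigroup_metric ::
  "'s set \<Rightarrow> ('s \<Rightarrow> 's \<Rightarrow> 's) \<Rightarrow> ('s \<Rightarrow> 's \<Rightarrow> ennreal) \<Rightarrow> bool" where
  "semigroup_metric S m d \<longleftrightarrow>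
     extended_metric_on S d \<and> uniformly_discrete_on S d \<and>
     metric_components S d = S // green_L S m"

definition right_subinvariant ::
  "'s set \<Rightarrow> ('s \<Rightarrow> 's \<Rightarrow> 's) \<Rightarrow> ('s \<Rightarrow> 's \<Rightarrow> ennreal) \<Rightarrow> bool" where
  "right_subinvariant S m d \<longleftrightarrow>
     (\<forall>s\<in>S. \<forall>t\<in>S. \<forall>x\<in>S. d (m s x) (m t x) \<le> d s t)"

definition proper_metric ::
  "'s set \<Rightarrow> ('s \<Rightarrow> 's \<Rightarrow> 's) \<Rightarrow> ('s \<Rightarrow> 's \<Rightarrow> ennreal) \<Rightarrow> bool" where
  "proper_metric S m d \<longleftrightarrow>
     (\<forall>r::real. r \<ge> 0 \<longrightarrow> (\<exists>F. finite F \<and> F \<subseteq> S \<and>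
        (\<forall>x\<in>S. \<forall>y\<in>S. x \<noteq> y \<and> d x y \<le> ennreal r \<longrightarrow> y \<in> (\<lambda>f. m f x) ` F)))"

end

theory Submission
  imports Defs
begin

text \<open>
  The semigroup consists of partial injections of \<open>X\<close> of bounded displacement, with enough of them
  to cover every entourage \<open>{(x, y). d x y \<le> R}\<close> by finitely many, together with all injections
  between one-point sets. The partial injections with domain \<open>{x\<^sub>0}\<close> form an \<open>\<L>\<close>-class which is
  identified with \<open>X\<close> through the image point. Properness controls \<open>d\<^sub>X\<close> by \<open>d\<^sub>S\<close>, as a finite
  subset of \<open>S\<close> has bounded displacement. Conversely, if \<open>y = t x\<close> then right subinvariance bounds
  the \<open>d\<^sub>S\<close>-distance between the points corresponding to \<open>x = t\<^sup>* t x\<close> and \<open>y\<close> by \<open>d\<^sub>S(t, t\<^sup>* t)\<close>,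
  which is finite because \<open>t\<close> and \<open>t\<^sup>* t\<close> are \<open>\<L>\<close>-related.
\<close>

section \<open>Control functions from two-sided bounds on distances\<close>

text \<open>The extremal control functions work: the supremum of the target distances over pairs at
  distance at most \<open>r\<close>, and their infimum over pairs at distance at least
  \<open>r\<close>. \<open>expansive\<close> keeps the supremum finite for finite \<open>r\<close>,
  and \<open>proper\<close> forces the infimum to tend to infinity.\<close>

lemma coarse_equivalence_surjI:
  assumes surj: "f ` A = B"
    and zero: "\<And>y. y \<in> B \<Longrightarrow> dB y y = 0"
    and expansive: "\<And>R. R < \<infinity> \<Longrightarrow>
      \<exists>M<\<infinity>. \<forall>x\<in>A. \<forall>y\<in>A. dA x y \<le> R \<longrightarrow> dB (f x) (f y) \<le> M"
    and proper: "\<And>R. R < \<infinity> \<Longrightarrow>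
      \<exists>M<\<infinity>. \<forall>x\<in>A. \<forall>y\<in>A. dB (f x) (f y) \<le> R \<longrightarrow> dA x y \<le> M"
  shows "coarse_equivalence A dA B dB f"
proof -
  \<comment> \<open>The value at infinity is set by hand, because the supremum over all pairs may be
    finite. In \<open>\<rho>m\<close> the infimum of the empty set is infinity, which is the right
    value when no pair is that far apart.\<close>
  define \<rho>p :: "ennreal \<Rightarrow> ennreal" where "\<rho>p r = (if r = \<infinity> then \<infinity> else
    Sup {dB (f x) (f y) |x y. x \<in> A \<and> y \<in> A \<and> dA x y \<le> r})" for r
  define \<rho>m :: "ennreal \<Rightarrow> ennreal" where "\<rho>m r =
    Inf {dB (f x) (f y) |x y. x \<in> A \<and> y \<in> A \<and> r \<le> dA x y}" for r
  have "mono \<rho>p"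
    unfolding mono_def \<rho>p_def
    by (auto simp: top_unique intro!: Sup_subset_mono dest: order_trans)
  moreover have "mono \<rho>m"
    unfolding mono_def \<rho>m_def
    by (auto intro!: Inf_superset_mono dest: order_trans)
  moreover have \<rho>p_finite: "\<rho>p r < \<infinity>" if r: "r < \<infinity>" for r
  proof -
    obtain M where "M < \<infinity>" "\<forall>x\<in>A. \<forall>y\<in>A. dA x y \<le> r \<longrightarrow> dB (f x) (f y) \<le> M"
      using expansive[OF r] by auto
    then have "\<rho>p r \<le> M"
      using r unfolding \<rho>p_def by (auto intro!: Sup_least)
    then show ?thesis using \<open>M < \<infinity>\<close> by (rule order_le_less_trans)
  qed
  have "\<rho>p -` {\<infinity>} = {\<infinity>}"
  proof -
    have "\<rho>p \<infinity> = \<infinity>" by (simp add: \<rho>p_def)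
    then have "\<rho>p r = \<infinity> \<longleftrightarrow> r = \<infinity>" for r
      using \<rho>p_finite[of r] by (cases "r = \<infinity>") (auto simp: less_top)
    then show ?thesis by auto
  qed
  moreover have "(\<rho>m \<longlongrightarrow> \<infinity>) (at \<infinity>)"
  proof (rule order_tendstoI)
    fix a :: ennreal assume a: "a < \<infinity>"
    obtain R where R: "a < R" "R < \<infinity>" using dense[OF a] by auto
    obtain M where M: "M < \<infinity>" "\<forall>x\<in>A. \<forall>y\<in>A. dB (f x) (f y) \<le> R \<longrightarrow> dA x y \<le> M"
      using proper[OF R(2)] by auto
    \<comment> \<open>By contraposition of \<open>M(2)\<close>, source distance above
      \<open>M\<close> forces target distance above \<open>R\<close>. The intermediate
      \<open>R\<close> keeps the inequality with \<open>a\<close> strict after passing to the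
      infimum.\<close>
    have "a < \<rho>m r" if "M < r" for r
    proof -
      have "R \<le> \<rho>m r"
        unfolding \<rho>m_def
      proof (rule Inf_greatest, clarify)
        fix x y assume "x \<in> A" "y \<in> A" "r \<le> dA x y"
        with M(2) that show "R \<le> dB (f x) (f y)"
          by (metis linorder_not_le nle_le order_le_less_trans)
      qed
      with R(1) show ?thesis by (rule less_le_trans)
    qed
    moreover have "eventually (\<lambda>r. M < r) (at \<infinity>)"
      using M(1) by (intro order_tendstoD(1)[OF tendsto_ident_at])
    ultimately show "eventually (\<lambda>r. a < \<rho>m r) (at \<infinity>)"
      by (auto elim: eventually_mono)
  qed auto
  moreover have "\<rho>m (dA x y) \<le> dB (f x) (f y)" "dB (f x) (f y) \<le> \<rho>p (dA x y)"
    if "x \<in> A" "y \<in> A" for x y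
    using that unfolding \<rho>m_def \<rho>p_def by (auto intro!: Inf_lower Sup_upper)
  moreover have "\<forall>y\<in>B. \<exists>x\<in>A. dB (f x) y \<le> ennreal 0"
    using surj zero by force
  ultimately show ?thesis
    unfolding coarse_equivalence_def using surj by (metis order_refl)
qed

section \<open>Consequences of bounded geometry\<close>

lemma bounded_geometry_ball:
  assumes "bounded_geometry_on X d" "R < \<infinity>"
  shows "\<exists>N. \<forall>x\<in>X. finite {y\<in>X. d x y \<le> R} \<and> card {y\<in>X. d x y \<le> R} \<le> N"
proof -
  \<comment> \<open>Bounded geometry speaks of positive real radii only, so the radius is enlarged
    by 1 to include \<open>R = 0\<close>.\<close>
  have "enn2real R + 1 > 0" by (simp add: add_nonneg_pos)
  with assms(1) obtain N where N: "\<forall>x\<in>X. finite (closed_ball_on X d (enn2real R + 1) x) \<and>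
      card (closed_ball_on X d (enn2real R + 1) x) \<le> N"
    unfolding bounded_geometry_on_def by blast
  have "R \<le> ennreal (enn2real R + 1)"
    using assms(2) by (metis ennreal_enn2real ennreal_leI infinity_ennreal_def less_add_one
        less_imp_le)
  then have "{y\<in>X. d x y \<le> R} \<subseteq> closed_ball_on X d (enn2real R + 1) x" for x
    by (auto simp: closed_ball_on_def)
  with N show ?thesis
    by (meson card_mono finite_subset order_trans)
qed

text \<open>As no distance is infinite, the balls of integer radius about a single point exhaust
  \<open>X\<close>, and each of them is finite.\<close>

lemma countable_if_finite_balls:
  assumes "non_extended_on X d" "bounded_geometry_on X d"
  shows "countable X"
proof (cases "X = {}")
  case False
  then obtain x0 where x0: "x0 \<in> X" by auto
  have "X \<subseteq> (\<Union>n::nat. {y\<in>X. d x0 y \<le> of_nat n})"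
  proof
    fix y assume y: "y \<in> X"
    then have "d x0 y < top" using assms(1) x0 by (auto simp: non_extended_on_def)
    then obtain n :: nat where "d x0 y < of_nat n"
      using ennreal_Ex_less_of_nat by blast
    with y show "y \<in> (\<Union>n::nat. {y\<in>X. d x0 y \<le> of_nat n})" by (auto intro: less_imp_le)
  qed
  moreover have "finite {y\<in>X. d x0 y \<le> of_nat n}" for n :: nat
    using bounded_geometry_ball[OF assms(2), of "of_nat n"] x0 by (auto simp: of_nat_less_top)
  ultimately show ?thesis
    by (meson countable_UN countable_finite countable_subset countableI_type)
qed auto

text \<open>With the points of each \<open>R\<close>-ball numbered by \<open>n x\<close>, colour the pair \<open>(x, y)\<close> by
  \<open>(n x y, n y x)\<close>.\<close>

lemma entourage_partial_injections:
  assumes "bounded_geometry_on X d" "R < \<infinity>"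
    and sym: "\<And>x y. x \<in> X \<Longrightarrow> y \<in> X \<Longrightarrow> d x y = d y x"
  shows "\<exists>T. finite T \<and> (\<forall>t\<in>T. single_valued t \<and> t\<inverse> \<in> T) \<and>
    \<Union>T = {(x, y). x \<in> X \<and> y \<in> X \<and> d x y \<le> R}"
proof -
  define E where "E = {(x, y). x \<in> X \<and> y \<in> X \<and> d x y \<le> R}"
  obtain N where N: "\<And>x. x \<in> X \<Longrightarrow> finite {y\<in>X. d x y \<le> R}"
      "\<And>x. x \<in> X \<Longrightarrow> card {y\<in>X. d x y \<le> R} \<le> N"
    using bounded_geometry_ball[OF assms(1,2)] by auto
  have "\<exists>n. inj_on n {y\<in>X. d x y \<le> R} \<and> n ` {y\<in>X. d x y \<le> R} \<subseteq> {..<N}" if "x \<in> X" for x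
    using card_le_inj[OF N(1)[OF that], of "{..<N}"] N(2)[OF that] by auto
  then obtain n where n: "\<And>x. x \<in> X \<Longrightarrow> inj_on (n x) {y\<in>X. d x y \<le> R}"
      "\<And>x. x \<in> X \<Longrightarrow> n x ` {y\<in>X. d x y \<le> R} \<subseteq> {..<N}"
    by metis
  define t where "t i j = {(x, y) \<in> E. n x y = i \<and> n y x = j}" for i j
  define T where "T = (\<lambda>(i, j). t i j) ` ({..<N} \<times> {..<N})"
  have E_sym: "(y, x) \<in> E" if "(x, y) \<in> E" for x y
    using that sym by (auto simp: E_def)
  have "finite T" by (simp add: T_def)
  moreover have "single_valued (t i j)" for i j
    using n(1) unfolding single_valued_def t_def E_def inj_on_def by force
  moreover have "(t i j)\<inverse> = t j i" for i j
    using E_sym by (auto simp: t_def)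
  moreover have "\<Union>T = E"
  proof
    show "E \<subseteq> \<Union>T"
    proof clarify
      fix x y assume xy: "(x, y) \<in> E"
      with E_sym[OF xy] n(2)[of x] n(2)[of y] have "n x y < N" "n y x < N"
        by (auto simp: E_def)
      with xy show "(x, y) \<in> \<Union>T" by (auto simp: T_def t_def)
    qed
  qed (auto simp: T_def t_def)
  ultimately show ?thesis
    unfolding E_def by (intro exI[of _ T]) (auto simp: T_def)
qed

section \<open>Countable semigroups generated by partial injections\<close>

text \<open>Finite words over a countable alphabet are countable, concatenation gives products, and
  reversing a word while inverting its letters gives converses. The parameter \<open>P\<close>
  carries an invariant of the generated elements; it will be bounded displacement.\<close>

lemma countable_closure_partial_injections:
  fixes G :: "('a \<times> 'a) set set"
  assumes "countable G"
    and G: "\<And>g. g \<in> G \<Longrightarrow> single_valued g \<and> g\<inverse> \<in> G \<and> g \<subseteq> X \<times> X"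
    and "P (Id_on X)"
    and P: "\<And>g r. g \<in> G \<Longrightarrow> P r \<Longrightarrow> P (g O r)"
  shows "\<exists>S. countable S \<and> G \<subseteq> S \<and>
    (\<forall>s\<in>S. single_valued s \<and> s\<inverse> \<in> S \<and> s \<subseteq> X \<times> X \<and> P s) \<and> (\<forall>s\<in>S. \<forall>t\<in>S. s O t \<in> S)"
proof -
  define w where "w gs = foldr (O) gs (Id_on X)" for gs :: "('a \<times> 'a) set list"
  define S where "S = w ` lists G"
  have sub: "w gs \<subseteq> X \<times> X" if "gs \<in> lists G" for gs
    using that
  proof (induction gs)
    case (Cons g gs)
    then show ?case using G[of g] by (auto simp: w_def)
  qed (auto simp: w_def)
  \<comment> \<open>The empty word denotes \<open>Id_on X\<close>, which is a left unit only for
    relations inside \<open>X \<times> X\<close>; hence the appeal to \<open>sub\<close>.\<close>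
  have append: "w gs O w hs = w (gs @ hs)" if "hs \<in> lists G" for gs hs
  proof (induction gs)
    case Nil
    then show ?case using sub[OF that] by (auto simp: w_def)
  qed (auto simp: w_def O_assoc)
  have comp: "s O t \<in> S" if "s \<in> S" "t \<in> S" for s t
  proof -
    from that obtain gs hs where "gs \<in> lists G" "hs \<in> lists G" "s = w gs" "t = w hs"
      by (auto simp only: S_def)
    then have "s O t = w (gs @ hs)" "gs @ hs \<in> lists G"
      using append by auto
    then show ?thesis by (simp only: S_def imageI)
  qed
  have "w [g] = g" if "g \<in> G" for g
    using G[OF that] by (auto simp: w_def)
  then have GS: "G \<subseteq> S"
    by (force simp: S_def)
  have conv: "(w gs)\<inverse> \<in> S" if "gs \<in> lists G" for gs
    using that
  proof (induction gs)
    case Nil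
    then show ?case by (auto simp: S_def w_def intro!: image_eqI[of _ _ "[]"])
  next
    case (Cons g gs)
    then have "(w gs)\<inverse> O g\<inverse> \<in> S"
      using G[of g] GS by (auto intro!: comp)
    then show ?case by (simp add: w_def converse_relcomp)
  qed
  have single: "single_valued (w gs)" if "gs \<in> lists G" for gs
    using that
  proof (induction gs)
    case (Cons g gs)
    then show ?case using G[of g] by (auto simp: w_def intro!: single_valued_relcomp)
  qed (auto simp: w_def)
  have P: "P (w gs)" if "gs \<in> lists G" for gs
    using that
  proof (induction gs)
    case (Cons g gs)
    then show ?case using P[of g "w gs"] by (auto simp: w_def)
  qed (use assms(3) in \<open>simp add: w_def\<close>)
  have "countable S"
    unfolding S_def using assms(1) by (intro countable_image countable_lists)
  then show ?thesis
    using GS comp conv single sub P by (intro exI[of _ S]) (auto simp: S_def)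
qed

section \<open>Inverse semigroups of partial injections and their Green classes\<close>

text \<open>A product \<open>m s t\<close> acts by \<open>t\<close> first; with \<open>s\<^sup>* s\<close> the identity on the domain of \<open>s\<close>, the
  \<open>\<L>\<close>-classes consist of the elements with the same domain.\<close>

locale partial_injection_semigroup =
  fixes S :: "'s set" and m :: "'s \<Rightarrow> 's \<Rightarrow> 's" and rel :: "'s \<Rightarrow> ('a \<times> 'a) set"
  assumes inj_rel: "inj_on rel S"
    and mult_closed: "s \<in> S \<Longrightarrow> t \<in> S \<Longrightarrow> m s t \<in> S"
    and rel_mult: "s \<in> S \<Longrightarrow> t \<in> S \<Longrightarrow> rel (m s t) = rel t O rel s"
    and single_valued_rel: "s \<in> S \<Longrightarrow> single_valued (rel s)"
    and converse_ex: "s \<in> S \<Longrightarrow> \<exists>t\<in>S. rel t = (rel s)\<inverse>"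
begin

lemma rel_eq_iff: "s \<in> S \<Longrightarrow> t \<in> S \<Longrightarrow> rel s = rel t \<longleftrightarrow> s = t"
  using inj_rel by (auto simp: inj_on_def)

lemma single_valued_converse_rel: "s \<in> S \<Longrightarrow> single_valued ((rel s)\<inverse>)"
  using converse_ex single_valued_rel by metis

lemma rel_domain_idem: "s \<in> S \<Longrightarrow> rel s O (rel s)\<inverse> = Id_on (Domain (rel s))"
  using single_valued_converse_rel[of s] by (auto simp: Id_on_iff dest: single_valuedD)

text \<open>A pair \<open>(x, y)\<close> of \<open>rel s\<close> factors as a path from
  \<open>x\<close> to \<open>y'\<close>, then by \<open>r\<close> to \<open>x'\<close>, then to
  \<open>y\<close>. Single-valuedness gives \<open>y' = y\<close> and injectivity gives
  \<open>x' = x\<close>, so the middle step is \<open>(y, x)\<close>.\<close>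

lemma converse_subset_inverse:
  assumes "s \<in> S" and "rel s O r O rel s = rel s"
  shows "(rel s)\<inverse> \<subseteq> r"
proof clarify
  fix x y assume xy: "(x, y) \<in> rel s"
  then obtain y' x' where "(x, y') \<in> rel s" "(y', x') \<in> r" "(x', y) \<in> rel s"
    using assms(2) by blast
  then show "(y, x) \<in> r"
    using xy single_valued_rel[OF assms(1)] single_valued_converse_rel[OF assms(1)]
    by (metis converse_iff single_valuedD)
qed

lemma is_semigroup_inverse_iff:
  assumes "s \<in> S"
  shows "is_semigroup_inverse S m s t \<longleftrightarrow> t \<in> S \<and> rel t = (rel s)\<inverse>"
proof
  assume "is_semigroup_inverse S m s t"
  then have t: "t \<in> S" and "m (m s t) s = s" "m (m t s) t = t"
    by (auto simp: is_semigroup_inverse_def)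
  then have "rel s O rel t O rel s = rel s" "rel t O rel s O rel t = rel t"
    using assms by (metis mult_closed rel_mult)+
  \<comment> \<open>The two defining equations of an inverse are symmetric in \<open>s\<close> and
    \<open>t\<close>, so the same lemma yields both inclusions.\<close>
  then have "(rel s)\<inverse> \<subseteq> rel t" "(rel t)\<inverse> \<subseteq> rel s"
    using assms t by (simp_all add: converse_subset_inverse)
  then show "t \<in> S \<and> rel t = (rel s)\<inverse>"
    using t by auto
next
  assume t: "t \<in> S \<and> rel t = (rel s)\<inverse>"
  have "rel (m (m s t) s) = rel s" "rel (m (m t s) t) = rel t"
    using assms t single_valued_rel[OF assms] single_valued_converse_rel[OF assms]
    by (auto simp: rel_mult mult_closed single_valued_def)
  then show "is_semigroup_inverse S m s t"
    using assms t by (metis is_semigroup_inverse_def rel_eq_iff mult_closed)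
qed

lemma inverse_unique: "s \<in> S \<Longrightarrow> \<exists>!t. is_semigroup_inverse S m s t"
  using converse_ex[of s] by (auto simp: is_semigroup_inverse_iff) (metis rel_eq_iff)

lemma star_closed: "s \<in> S \<Longrightarrow> star S m s \<in> S"
  and rel_star: "s \<in> S \<Longrightarrow> rel (star S m s) = (rel s)\<inverse>"
  using theI'[OF inverse_unique, of s] is_semigroup_inverse_iff[of s]
  by (auto simp: star_def)

lemma inverse_semigroup: "inverse_semigroup_on S m"
proof -
  have "m (m s t) u = m s (m t u)" if "s \<in> S" "t \<in> S" "u \<in> S" for s t u
    using that by (subst rel_eq_iff[symmetric]) (auto simp: rel_mult mult_closed)
  then show ?thesis
    by (simp add: inverse_semigroup_on_def mult_closed inverse_unique)
qed

lemma rel_star_mult: "s \<in> S \<Longrightarrow> rel (m (star S m s) s) = Id_on (Domain (rel s))"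
  by (simp add: rel_mult star_closed rel_star rel_domain_idem)

lemma green_L_iff:
  "(s, t) \<in> green_L S m \<longleftrightarrow> s \<in> S \<and> t \<in> S \<and> Domain (rel s) = Domain (rel t)"
proof -
  have "m (star S m s) s = m (star S m t) t \<longleftrightarrow> Domain (rel s) = Domain (rel t)"
    if "s \<in> S" "t \<in> S"
  proof -
    have "m (star S m s) s = m (star S m t) t \<longleftrightarrow>
        rel (m (star S m s) s) = rel (m (star S m t) t)"
      using that by (simp add: rel_eq_iff mult_closed star_closed)
    also have "\<dots> \<longleftrightarrow> Domain (rel s) = Domain (rel t)"
      using that by (metis Domain_Id_on rel_star_mult)
    finally show ?thesis .
  qed
  then show ?thesis by (auto simp: green_L_def)
qed

lemma dist_finite:
  assumes "semigroup_metric S m d" "(s, t) \<in> green_L S m"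
  shows "d s t < \<infinity>"
proof -
  have S: "s \<in> S" "t \<in> S" using assms(2) by (auto simp: green_L_iff)
  let ?E = "{(x, y). x \<in> S \<and> y \<in> S \<and> d x y < \<infinity>}"
  have "green_L S m `` {s} \<in> S // ?E"
    using assms(1) S by (metis metric_components_def quotientI semigroup_metric_def)
  \<comment> \<open>Equality of the two quotients only says that the class of \<open>s\<close> is
    the component of some point \<open>u\<close>, so \<open>s\<close> and \<open>t\<close> are
    compared through \<open>u\<close>.\<close>
  then obtain u where u: "u \<in> S" "green_L S m `` {s} = ?E `` {u}"
    by (auto elim: quotientE)
  have "s \<in> ?E `` {u}" "t \<in> ?E `` {u}"
    using assms(2) S unfolding u(2)[symmetric] by (auto simp: green_L_iff)
  then have "d u s < \<infinity>" "d u t < \<infinity>" by auto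
  moreover have "d s t \<le> d s u + d u t" "d s u = d u s"
    using assms(1) S u(1) unfolding semigroup_metric_def extended_metric_on_def by auto
  ultimately show ?thesis
    by (auto simp: ennreal_add_less_top elim!: order_le_less_trans)
qed

section \<open>The coarse equivalence between a Green class and the space\<close>

text \<open>Evaluation at \<open>x0\<close> is the bijection, onto by \<open>singletons\<close>.
  Properness of \<open>d\<close> together with \<open>bounded\<close> controls \<open>dX\<close> by
  \<open>d\<close>; right subinvariance together with \<open>cover\<close> controls \<open>d\<close>
  by \<open>dX\<close>.\<close>

lemma green_class_coarsely_equivalent:
  assumes d: "semigroup_metric S m d" "proper_metric S m d" "right_subinvariant S m d"
    and dX: "extended_metric_on X dX"
    and carrier: "\<And>s. s \<in> S \<Longrightarrow> rel s \<subseteq> X \<times> X"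
    and bounded: "\<And>s. s \<in> S \<Longrightarrow> \<exists>K<\<infinity>. \<forall>(x, y)\<in>rel s. dX x y \<le> K"
    and singletons: "\<And>x y. x \<in> X \<Longrightarrow> y \<in> X \<Longrightarrow> \<exists>s\<in>S. rel s = {(x, y)}"
    and cover: "\<And>R. R < \<infinity> \<Longrightarrow> \<exists>T. finite T \<and> T \<subseteq> S \<and>
      (\<forall>x\<in>X. \<forall>y\<in>X. dX x y \<le> R \<longrightarrow> (\<exists>t\<in>T. (x, y) \<in> rel t))"
    and e: "e \<in> S" "rel e = {(x0, x0)}"
  shows "bijectively_coarsely_equivalent (green_L S m `` {e}) d X dX"
proof -
  let ?L = "green_L S m `` {e}"
  have x0: "x0 \<in> X" using carrier[OF e(1)] e(2) by auto
  have L: "s \<in> ?L \<longleftrightarrow> s \<in> S \<and> (\<exists>y\<in>X. rel s = {(x0, y)})" for s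
  proof
    assume "s \<in> ?L"
    then have s: "s \<in> S" "Domain (rel s) = {x0}" by (auto simp: green_L_iff e)
    then obtain y where y: "(x0, y) \<in> rel s" by blast
    have "(x0, z) \<in> rel s \<longleftrightarrow> z = y" for z
      using y single_valued_rel[OF s(1)] by (auto simp: single_valued_def)
    moreover have "x = x0" if "(x, z) \<in> rel s" for x z
      using that s(2) by blast
    ultimately have "rel s = {(x0, y)}" by auto
    with s(1) y carrier[OF s(1)] show "s \<in> S \<and> (\<exists>y\<in>X. rel s = {(x0, y)})" by auto
  qed (auto simp: green_L_iff e)
  define f where "f s = snd (the_elem (rel s))" for s
  have rel_f: "rel s = {(x0, f s)}" "s \<in> S" "f s \<in> X" if "s \<in> ?L" for s
  proof -
    from that obtain y where "s \<in> S" "y \<in> X" "rel s = {(x0, y)}"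
      unfolding L by blast
    then show "rel s = {(x0, f s)}" "s \<in> S" "f s \<in> X" by (simp_all add: f_def)
  qed
  have f_eq: "f s = y" if "rel s = {(x0, y)}" for s y
    using that by (simp add: f_def)
  have inj: "inj_on f ?L"
    by (rule inj_onI) (metis rel_f rel_eq_iff)
  have surj: "f ` ?L = X"
  proof
    show "X \<subseteq> f ` ?L"
    proof
      fix y assume y: "y \<in> X"
      then obtain s where "s \<in> S" "rel s = {(x0, y)}" using singletons x0 by blast
      with y show "y \<in> f ` ?L" by (intro image_eqI[of _ _ s]) (auto simp: L f_eq simp del: Image_singleton_iff)
    qed
  qed (use rel_f in auto)
  have zero: "dX y y = 0" if "y \<in> X" for y
    using dX that by (auto simp: extended_metric_on_def)
  have "coarse_equivalence ?L d X dX f"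
  proof (rule coarse_equivalence_surjI[OF surj zero])
    fix R :: ennreal assume R: "R < \<infinity>"
    obtain F where F: "finite F" "F \<subseteq> S"
      "\<And>s t. s \<in> S \<Longrightarrow> t \<in> S \<Longrightarrow> s \<noteq> t \<Longrightarrow> d s t \<le> R \<Longrightarrow> t \<in> (\<lambda>g. m g s) ` F"
    proof -
      have "ennreal (enn2real R) = R" using R by (simp add: less_top)
      then show ?thesis
        using d(2) that unfolding proper_metric_def by (metis enn2real_nonneg)
    qed
    \<comment> \<open>Each \<open>g\<close> in the finite set \<open>F\<close> has its own
      displacement bound; their sum serves as a common one.\<close>
    obtain K where K: "\<And>g. g \<in> F \<Longrightarrow> K g < \<infinity>"
      "\<And>g x y. g \<in> F \<Longrightarrow> (x, y) \<in> rel g \<Longrightarrow> dX x y \<le> K g"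
    proof -
      have "\<forall>g\<in>F. \<exists>K. K < \<infinity> \<and> (\<forall>x y. (x, y) \<in> rel g \<longrightarrow> dX x y \<le> K)"
        using bounded F(2) by fastforce
      then obtain K where "\<forall>g\<in>F. K g < \<infinity> \<and> (\<forall>x y. (x, y) \<in> rel g \<longrightarrow> dX x y \<le> K g)"
        unfolding bchoice_iff by blast
      then show ?thesis by (intro that[of K]) auto
    qed
    have "dX (f s) (f t) \<le> sum K F" if st: "s \<in> ?L" "t \<in> ?L" "d s t \<le> R" for s t
    proof (cases "s = t")
      case True
      then show ?thesis
        using zero[OF rel_f(3)[OF st(2)]] by simp
    next
      case False
      then obtain g where g: "g \<in> F" "t = m g s"
        using F(3) rel_f(2) st by blast
      \<comment> \<open>In \<open>m g s\<close> the factor \<open>s\<close> acts first, so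
        \<open>g\<close> must carry \<open>f s\<close> to \<open>f t\<close>, and the displacement
        bound of \<open>g\<close> applies.\<close>
      have "rel t = rel s O rel g"
        unfolding g(2) using g(1) F(2) rel_f(2)[OF st(1)] by (intro rel_mult) auto
      then have "(x0, f t) \<in> {(x0, f s)} O rel g"
        using rel_f(1)[OF st(1)] rel_f(1)[OF st(2)] by auto
      then have "(f s, f t) \<in> rel g" by auto
      with K(2)[OF g(1)] member_le_sum[OF g(1), of K] F(1) show ?thesis
        by (meson order_trans zero_le)
    qed
    moreover have "sum K F < \<infinity>" using F(1) K(1) by simp
    ultimately show "\<exists>M<\<infinity>. \<forall>s\<in>?L. \<forall>t\<in>?L. d s t \<le> R \<longrightarrow> dX (f s) (f t) \<le> M" by blast
  next
    fix R :: ennreal assume R: "R < \<infinity>"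
    obtain T where T: "finite T" "T \<subseteq> S"
      "\<And>x y. x \<in> X \<Longrightarrow> y \<in> X \<Longrightarrow> dX x y \<le> R \<Longrightarrow> \<exists>t\<in>T. (x, y) \<in> rel t"
      using cover[OF R] by blast
    define K where "K t = d (m (star S m t) t) t" for t
    have "K t < \<infinity>" if "t \<in> T" for t
    proof -
      have "t \<in> S" using T(2) that by auto
      \<comment> \<open>Both elements have the domain of \<open>t\<close>, so their distance is
        finite.\<close>
      then have "(m (star S m t) t, t) \<in> green_L S m"
        by (simp only: green_L_iff rel_star_mult mult_closed star_closed Domain_Id_on)
      then show ?thesis
        unfolding K_def by (rule dist_finite[OF d(1)])
    qed
    then have "sum K T < \<infinity>" using T(1) by simp
    moreover have "d s s' \<le> sum K T"
      if s: "s \<in> ?L" "s' \<in> ?L" "dX (f s) (f s') \<le> R" for s s'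
    proof -
      obtain t where t: "t \<in> T" "(f s, f s') \<in> rel t"
        using T(3) s rel_f(3) by metis
      have S: "t \<in> S" "s \<in> S" "s' \<in> S" using t(1) T(2) s rel_f(2) by auto
      \<comment> \<open>Right multiplication by \<open>s\<close> sends the pair of
        \<open>m (star S m t) t\<close> and \<open>t\<close> to the pair of \<open>s\<close> and
        \<open>s'\<close>, so right subinvariance bounds \<open>d s s'\<close> by
        \<open>K t\<close>.\<close>
      have "rel (m (m (star S m t) t) s) = rel s"
        using S t(2) rel_f(1)[OF s(1)]
        by (auto simp: rel_mult[of "m (star S m t) t"] rel_star_mult mult_closed star_closed)
      moreover have "rel (m t s) = rel s'"
        using S t(2) rel_f(1)[OF s(1)] rel_f(1)[OF s(2)] single_valued_rel[OF S(1)]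
        by (auto simp: rel_mult single_valued_def)
      ultimately have "m (m (star S m t) t) s = s" "m t s = s'"
        using S by (auto simp: rel_eq_iff mult_closed star_closed)
      then have "d s s' \<le> K t"
        using d(3) S unfolding right_subinvariant_def K_def
        by (metis mult_closed star_closed)
      with member_le_sum[OF t(1), of K] T(1) show ?thesis
        by (meson order_trans zero_le)
    qed
    ultimately show "\<exists>M<\<infinity>. \<forall>s\<in>?L. \<forall>t\<in>?L. dX (f s) (f t) \<le> R \<longrightarrow> d s t \<le> M" by blast
  qed
  with inj surj show ?thesis
    by (auto simp: bijectively_coarsely_equivalent_def bij_betw_def)
qed

end

section \<open>A countable semigroup of bounded displacement covering all entourages\<close>

lemma bounded_displacement_semigroup:
  assumes dX: "extended_metric_on X d" "non_extended_on X d" "bounded_geometry_on X d"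
  shows "\<exists>S :: ('a \<times> 'a) set set. countable S \<and>
    (\<forall>s\<in>S. single_valued s \<and> s\<inverse> \<in> S \<and> s \<subseteq> X \<times> X \<and> (\<exists>K<\<infinity>. \<forall>(x, y)\<in>s. d x y \<le> K)) \<and>
    (\<forall>s\<in>S. \<forall>t\<in>S. s O t \<in> S) \<and>
    (\<forall>x\<in>X. \<forall>y\<in>X. {(x, y)} \<in> S) \<and>
    (\<forall>R<\<infinity>. \<exists>T. finite T \<and> T \<subseteq> S \<and> (\<forall>x\<in>X. \<forall>y\<in>X. d x y \<le> R \<longrightarrow> (\<exists>t\<in>T. (x, y) \<in> t)))"
proof -
  have sym: "d x y = d y x" and zero: "d x x = 0"
    and triangle: "z \<in> X \<Longrightarrow> d x z \<le> d x y + d y z" if "x \<in> X" "y \<in> X" for x y z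
    using dX(1) that unfolding extended_metric_on_def by auto
  \<comment> \<open>Integer radii keep the family of generators countable and still dominate every
    finite \<open>R\<close>.\<close>
  have "\<exists>T. finite T \<and> (\<forall>t\<in>T. single_valued t \<and> t\<inverse> \<in> T) \<and>
      \<Union>T = {(x, y). x \<in> X \<and> y \<in> X \<and> d x y \<le> of_nat k}" for k :: nat
    by (rule entourage_partial_injections[OF dX(3) _ sym]) (auto simp: of_nat_less_top)
  then obtain T where T: "\<And>k. finite (T k)" "\<And>k t. t \<in> T k \<Longrightarrow> single_valued t \<and> t\<inverse> \<in> T k"
      "\<And>k::nat. \<Union>(T k) = {(x, y). x \<in> X \<and> y \<in> X \<and> d x y \<le> of_nat k}"
    by metis
  define G where "G = (\<lambda>p. {p}) ` (X \<times> X) \<union> (\<Union>k. T k)"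
  \<comment> \<open>The invariant includes \<open>s \<subseteq> X \<times> X\<close> because the
    triangle inequality is available on \<open>X\<close> only. Under composition the displacement
    bounds add.\<close>
  define P where "P s \<longleftrightarrow> s \<subseteq> X \<times> X \<and> (\<exists>K<\<infinity>. \<forall>(x, y)\<in>s. d x y \<le> K)" for s
  have "countable G"
    unfolding G_def using T(1) countable_if_finite_balls[OF dX(2,3)]
    by (auto intro: countable_finite)
  moreover have G: "single_valued g \<and> g\<inverse> \<in> G \<and> g \<subseteq> X \<times> X" if "g \<in> G" for g
  proof (cases "g \<in> (\<Union>k. T k)")
    case True
    then obtain k where k: "g \<in> T k" by auto
    then have "g \<subseteq> \<Union>(T k)" by auto
    with k T(2)[OF k] show ?thesis unfolding G_def T(3) by auto
  next
    case False
    with that obtain x y where "g = {(x, y)}" "x \<in> X" "y \<in> X" by (auto simp: G_def)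
    moreover from this have "g\<inverse> = {(y, x)}" by auto
    ultimately show ?thesis by (auto simp: G_def single_valued_def)
  qed
  moreover have "P (Id_on X)"
    by (auto simp: P_def zero intro!: exI[of _ 0])
  moreover have "P (g O r)" if g: "g \<in> G" and r: "P r" for g r
  proof -
    have "\<exists>K<\<infinity>. \<forall>(x, y)\<in>g. d x y \<le> K"
    proof (cases "g \<in> (\<Union>k. T k)")
      case True
      then obtain k where "g \<subseteq> \<Union>(T k)" by auto
      then show ?thesis
        unfolding T(3) by (intro exI[of _ "of_nat k"]) (auto simp: of_nat_less_top)
    next
      \<comment> \<open>The other generators are single pairs, whose displacement is finite because
        \<open>X\<close> is non-extended.\<close>
      case False
      with g obtain x y where "g = {(x, y)}" "x \<in> X" "y \<in> X" by (auto simp: G_def)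
      then show ?thesis
        using dX(2) by (auto simp: non_extended_on_def intro!: exI[of _ "d x y"])
    qed
    then obtain K where K: "K < \<infinity>" "\<And>x y. (x, y) \<in> g \<Longrightarrow> d x y \<le> K" by auto
    obtain K' where K': "K' < \<infinity>" "\<And>x y. (x, y) \<in> r \<Longrightarrow> d x y \<le> K'" and rX: "r \<subseteq> X \<times> X"
      using r unfolding P_def by blast
    have gX: "g \<subseteq> X \<times> X" using G[OF g] by simp
    have "d x z \<le> K + K'" if "(x, y) \<in> g" "(y, z) \<in> r" for x y z
    proof -
      have "d x z \<le> d x y + d y z" using that gX rX by (auto intro!: triangle)
      also have "\<dots> \<le> K + K'" using that K(2) K'(2) by (intro add_mono)
      finally show ?thesis .
    qed
    moreover have "K + K' < \<infinity>" using K(1) K'(1) by (simp add: ennreal_add_less_top)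
    ultimately show ?thesis
      using gX rX unfolding P_def by (intro conjI exI[of _ "K + K'"]) auto
  qed
  ultimately obtain S where S: "countable S" "G \<subseteq> S"
      "\<forall>s\<in>S. single_valued s \<and> s\<inverse> \<in> S \<and> s \<subseteq> X \<times> X \<and> P s" "\<forall>s\<in>S. \<forall>t\<in>S. s O t \<in> S"
    using countable_closure_partial_injections[of G X P] by auto
  have "\<exists>T. finite T \<and> T \<subseteq> S \<and> (\<forall>x\<in>X. \<forall>y\<in>X. d x y \<le> R \<longrightarrow> (\<exists>t\<in>T. (x, y) \<in> t))"
    if R: "R < \<infinity>" for R
  proof -
    obtain k :: nat where k: "R < of_nat k" using R ennreal_Ex_less_of_nat by auto
    have "\<exists>t\<in>T k. (x, y) \<in> t" if "x \<in> X" "y \<in> X" "d x y \<le> R" for x y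
    proof -
      have "(x, y) \<in> \<Union>(T k)" unfolding T(3) using that k by auto
      then show ?thesis by auto
    qed
    moreover have "T k \<subseteq> S" using S(2) by (force simp: G_def)
    ultimately show ?thesis using T(1) by (intro exI[of _ "T k"]) auto
  qed
  moreover have "\<forall>x\<in>X. \<forall>y\<in>X. {(x, y)} \<in> S" using S(2) by (auto simp: G_def)
  ultimately show ?thesis
    using S by (intro exI[of _ S]) (auto simp: P_def)
qed

section \<open>Transport of the semigroup to the natural numbers\<close>

theorem theorem2:
  fixes X :: "'a set" and dX :: "'a \<Rightarrow> 'a \<Rightarrow> ennreal"
  assumes "extended_metric_on X dX"
    and "non_extended_on X dX"
    and "bounded_geometry_on X dX"
    and "infinite X"
  shows "\<exists>(S :: nat set) (m :: nat \<Rightarrow> nat \<Rightarrow> nat) L.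
           inverse_semigroup_on S m \<and> countable S \<and> L \<in> S // green_L S m \<and>
           (\<forall>dS :: nat \<Rightarrow> nat \<Rightarrow> ennreal.
              semigroup_metric S m dS \<and> proper_metric S m dS \<and> right_subinvariant S m dS
              \<longrightarrow> bijectively_coarsely_equivalent L dS X dX)"
proof -
  obtain x0 where x0: "x0 \<in> X" using assms(4) by fastforce
  obtain I :: "('a \<times> 'a) set set" where countable: "countable I"
    and *: "\<forall>s\<in>I. single_valued s \<and> s\<inverse> \<in> I \<and> s \<subseteq> X \<times> X \<and>
      (\<exists>K<\<infinity>. \<forall>(x, y)\<in>s. dX x y \<le> K)"
    and comp: "\<forall>s\<in>I. \<forall>t\<in>I. s O t \<in> I"
    and singletons: "\<forall>x\<in>X. \<forall>y\<in>X. {(x, y)} \<in> I"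
    and cover: "\<forall>R<\<infinity>. \<exists>T. finite T \<and> T \<subseteq> I \<and>
      (\<forall>x\<in>X. \<forall>y\<in>X. dX x y \<le> R \<longrightarrow> (\<exists>t\<in>T. (x, y) \<in> t))"
    using bounded_displacement_semigroup[OF assms(1-3)] by (elim exE conjE) (rule that)
  have I: "single_valued s" "s\<inverse> \<in> I" "s \<subseteq> X \<times> X" "\<exists>K<\<infinity>. \<forall>(x, y)\<in>s. dX x y \<le> K"
    if "s \<in> I" for s
    using * that by auto
  \<comment> \<open>The countable semigroup \<open>I\<close> of relations is coded by natural
    numbers, with \<open>rel\<close> decoding. Relational composition applies its left factor first,
    so \<open>m\<close> reverses the order to let \<open>t\<close> act before
    \<open>s\<close>.\<close>
  define c where "c = to_nat_on I"
  define rel where "rel = from_nat_into I"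
  define S where "S = c ` I"
  define m where "m s t = c (rel t O rel s)" for s t
  have rel_c: "rel (c s) = s" if "s \<in> I" for s
    using that countable by (simp add: rel_def c_def)
  have rel_I: "rel s \<in> I" if "s \<in> S" for s
    using that rel_c by (auto simp: S_def)
  interpret partial_injection_semigroup S m rel
  proof
    show "inj_on rel S" by (auto simp: S_def inj_on_def rel_c)
    show "m s t \<in> S" "rel (m s t) = rel t O rel s" if "s \<in> S" "t \<in> S" for s t
      using that by (auto simp: m_def rel_c rel_I comp) (simp add: S_def rel_I comp)
    show "single_valued (rel s)" "\<exists>t\<in>S. rel t = (rel s)\<inverse>" if "s \<in> S" for s
      using I(1,2)[OF rel_I[OF that]] by (auto simp: S_def rel_c)
  qed
  have ex_rel: "\<exists>s\<in>S. rel s = {(x, y)}" if "x \<in> X" "y \<in> X" for x y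
    using singletons that by (auto simp: S_def rel_c)
  \<comment> \<open>The class of \<open>e\<close> is fixed before any metric is considered, so the
    same class serves every \<open>dS\<close>.\<close>
  then obtain e where e: "e \<in> S" "rel e = {(x0, x0)}" using x0 by blast
  have "\<exists>T. finite T \<and> T \<subseteq> S \<and> (\<forall>x\<in>X. \<forall>y\<in>X. dX x y \<le> R \<longrightarrow> (\<exists>t\<in>T. (x, y) \<in> rel t))"
    if R: "R < \<infinity>" for R
  proof -
    obtain T where "finite T" "T \<subseteq> I" "\<forall>x\<in>X. \<forall>y\<in>X. dX x y \<le> R \<longrightarrow> (\<exists>t\<in>T. (x, y) \<in> t)"
      using cover[THEN spec, THEN mp, OF R] by (elim exE conjE) (rule that)
    then show ?thesis
      by (intro exI[of _ "c ` T"]) (auto simp: S_def rel_c subset_iff)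
  qed
  then have "bijectively_coarsely_equivalent (green_L S m `` {e}) dS X dX"
    if "semigroup_metric S m dS" "proper_metric S m dS" "right_subinvariant S m dS" for dS
    using I(3,4) rel_I ex_rel
    by (intro green_class_coarsely_equivalent[OF that assms(1) _ _ _ _ e]) auto
  moreover have "green_L S m `` {e} \<in> S // green_L S m"
    using e(1) by (rule quotientI)
  ultimately show ?thesis
    using inverse_semigroup by blast
qed

end
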